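(* Let $n=2p_{1}^{J_{1}}p_{2}^{J_{2}}\cdots p_{s}^{J_{s}}$, where $s\geq2$, $p_1,\dots,p_s$ are distinct odd primes, $J_i\ge1$, and for every $r\in\{1,\dots,s-1\}$ we have $\prod_{i=1}^{r}p_{i}^{J_{i}}<p_{r+1}$. Let $\mathcal{D}_{S_{1}},\mathcal{D}_{S_{2}}$ be subsets of $\mathcal{D}_{[n]}\setminus\{n\}$. If $\mathrm{Spec}(\mathrm{ICG}(n,\mathcal{D}_{S_{1}}))=\mathrm{Spec}(\mathrm{ICG}(n,\mathcal{D}_{S_{2}}))$, then $\mathcal{D}_{S_{1}}=\mathcal{D}_{S_{2}}$.
   Context: For an integer $n\ge1$, identify $\mathbb{Z}_n$ with $[n]=\{1,\dots,n\}$ ($n$ playing the role of $0$). For a positive divisor $d$ of $n$, $G_n(d)=\{j\in[n]:\gcd(j,n)=d\}$. $\mathcal{D}_{[n]}$ denotes the set of all positive divisors of $n$. For $\mathcal{D}\subseteq\mathcal{D}_{[n]}\setminus\{n\}$, $\mathrm{ICG}(n,\mathcal{D})$ denotes the circulant graph $\mathrm{Cay}(\mathbb{Z}_n,S)$ with connection set $S=\bigcup_{d\in\mathcal{D}}G_n(d)$ (vertex set $\mathbb{Z}_n$, $g\sim h$ iff $h-g\in S$); we write $\mathcal{D}=\mathcal{D}_S$. $\mathrm{Spec}$ denotes the multiset of eigenvalues of the adjacency matrix. *)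

theory Defs
  imports "Jordan_Normal_Form.Char_Poly" "HOL-Computational_Algebra.Fundamental_Theorem_Algebra"
begin

text \<open>Z_n identified with [n] = {1..n}; the representative in [n] of an integer a.\<close>
definition zn_rep :: "nat \<Rightarrow> int \<Rightarrow> nat" where
  "zn_rep n a = (if a mod int n = 0 then n else nat (a mod int n))"

definition G_n :: "nat \<Rightarrow> nat \<Rightarrow> nat set" where
  "G_n n d = {j \<in> {1..n}. gcd j n = d}"

definition divisors_n :: "nat \<Rightarrow> nat set" where
  "divisors_n n = {d. 0 < d \<and> d dvd n}"

definition conn_set :: "nat \<Rightarrow> nat set \<Rightarrow> nat set" where
  "conn_set n D = (\<Union>d\<in>D. G_n n d)"

text \<open>Adjacency matrix of Cay(Z_n, S), vertices 1..n stored at matrix indices 0..n-1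
  (vertex g at index g-1); g ~ h iff h - g in S (taken in [n]).\<close>
definition circulant_adj :: "nat \<Rightarrow> nat set \<Rightarrow> complex mat" where
  "circulant_adj n S = mat n n (\<lambda>(i, j).
     if zn_rep n (int (j + 1) - int (i + 1)) \<in> S then 1 else 0)"

definition ICG_adj :: "nat \<Rightarrow> nat set \<Rightarrow> complex mat" where
  "ICG_adj n D = circulant_adj n (conn_set n D)"

definition Spec :: "complex mat \<Rightarrow> complex multiset" where
  "Spec A = proots (char_poly A)"

end

theory Submission
  imports Defs "HOL-Number_Theory.Totient" "HOL-Library.Real_Mod"
begin

text \<open>Write \<open>n = 2m\<close> with \<open>m\<close> odd. The eigenvalues \<open>e k\<close> of the graph satisfy
  \<open>e (n - k) = e k\<close>, because the connection set is closed under negation. Hence the spectrum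
  consists of \<open>e 0\<close>, \<open>e m\<close> and eigenvalues that occur in pairs. Since \<open>e 0\<close> is the degree, the
  largest modulus of an eigenvalue, the spectrum determines \<open>e 0\<close> and then, by the parity of
  multiplicities, \<open>e m\<close>. They are the sum and the difference of the numbers of even and odd
  elements of the connection set, and each of these numbers is a sum of Euler's totient function
  over distinct divisors of \<open>m\<close>.

  The growth condition on the primes makes such subset sums unique. If this holds for the divisors
  of \<open>m\<close> and \<open>q\<close> is a prime with \<open>m < q - 1\<close>, then the divisors of \<open>m * q ^ (k + 1)\<close> that are
  multiples of \<open>q ^ (k + 1)\<close> contribute a multiple of \<open>totient (q ^ (k + 1)) = (q - 1) * q ^ k\<close>,
  while all others together contribute at most \<open>m * q ^ k\<close>, which is smaller. The two parts of a
  subset sum are therefore its quotient and remainder. So the two numbers determine the divisor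
  set.\<close>

section \<open>Distinct subset sums\<close>

definition distinct_subset_sums :: "('a \<Rightarrow> 'b::comm_monoid_add) \<Rightarrow> 'a set \<Rightarrow> bool" where
  "distinct_subset_sums f A \<longleftrightarrow> inj_on (sum f) (Pow A)"

lemma distinct_subset_sumsD:
  assumes "distinct_subset_sums f A" "X \<subseteq> A" "Y \<subseteq> A" "sum f X = sum f Y"
  shows "X = Y"
  using assms by (auto simp: distinct_subset_sums_def dest: inj_onD)

lemma distinct_subset_sums_pullback:
  fixes f :: "'a \<Rightarrow> 'c::semiring_no_zero_divisors_cancel" and g :: "'b \<Rightarrow> 'c"
  assumes distinct: "distinct_subset_sums f A"
    and inj: "inj_on h B" and image: "h ` B \<subseteq> A"
    and scaled: "\<And>b. b \<in> B \<Longrightarrow> g b = c * f (h b)" and "c \<noteq> 0"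
  shows "distinct_subset_sums g B"
  unfolding distinct_subset_sums_def
proof (rule inj_onI)
  fix X Y assume XY: "X \<in> Pow B" "Y \<in> Pow B" and eq: "sum g X = sum g Y"
  have "sum g Z = c * sum f (h ` Z)" if "Z \<subseteq> B" for Z
  proof -
    have "sum g Z = (\<Sum>b\<in>Z. c * f (h b))" by (rule sum.cong) (use that scaled in auto)
    also have "\<dots> = c * sum f (h ` Z)"
      using inj_on_subset[OF inj that] by (simp add: sum.reindex sum_distrib_left)
    finally show ?thesis .
  qed
  then have "sum f (h ` X) = sum f (h ` Y)" using XY eq \<open>c \<noteq> 0\<close> by auto
  then have "h ` X = h ` Y" using XY image by (intro distinct_subset_sumsD[OF distinct]) auto
  then show "X = Y" using XY inj by (simp add: inj_on_image_eq_iff)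
qed

lemma distinct_subset_sums_Un:
  fixes f :: "'a \<Rightarrow> nat"
  assumes fin: "finite A" "finite B"
    and distinct: "distinct_subset_sums f A" "distinct_subset_sums f B"
    and less: "sum f A < c" and dvd: "\<And>b. b \<in> B \<Longrightarrow> c dvd f b"
  shows "distinct_subset_sums f (A \<union> B)"
  unfolding distinct_subset_sums_def
proof (rule inj_onI)
  fix X Y assume "X \<in> Pow (A \<union> B)" "Y \<in> Pow (A \<union> B)" and eq: "sum f X = sum f Y"
  then have sub: "X \<subseteq> A \<union> B" "Y \<subseteq> A \<union> B" by auto
  have split: "sum f Z = sum f (Z \<inter> A) + sum f (Z - A)" if "Z \<subseteq> A \<union> B" for Z
    using that fin by (intro sum.Int_Diff) (auto intro: finite_subset)
  have residue: "sum f Z mod c = sum f (Z \<inter> A)" if "Z \<subseteq> A \<union> B" for Z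
  proof -
    have "c dvd sum f (Z - A)" using that dvd by (intro dvd_sum) auto
    moreover have "sum f (Z \<inter> A) \<le> sum f A" using fin by (intro sum_mono2) auto
    ultimately show ?thesis using split[OF that] less by auto
  qed
  have sum_Int: "sum f (X \<inter> A) = sum f (Y \<inter> A)" using residue sub eq by metis
  then have "X \<inter> A = Y \<inter> A" by (intro distinct_subset_sumsD[OF distinct(1)]) auto
  moreover have "sum f (X - A) = sum f (Y - A)"
    using split sub eq sum_Int by (metis add_left_cancel)
  then have "X - A = Y - A" using sub by (intro distinct_subset_sumsD[OF distinct(2)]) auto
  ultimately show "X = Y" by blast
qed

lemma divisors_mult_prime_power_Suc:
  fixes m q k :: nat
  assumes "prime q"
  shows "{d. d dvd m * q ^ Suc k} =
    {d. d dvd m * q ^ k} \<union> (\<lambda>d. d * q ^ Suc k) ` {d. d dvd m}"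
    (is "?L = ?R")
proof
  show "?R \<subseteq> ?L"
  proof (rule Un_least)
    show "{d. d dvd m * q ^ k} \<subseteq> ?L" by (auto simp: mult.left_commute[of m] intro: dvd_mult)
    show "(\<lambda>d. d * q ^ Suc k) ` {d. d dvd m} \<subseteq> ?L" by (auto intro: mult_dvd_mono)
  qed
  show "?L \<subseteq> ?R"
  proof
    fix d assume "d \<in> ?L"
    then obtain e c where factors: "d = e * c" "e dvd m" "c dvd q ^ Suc k"
      using division_decomp by blast
    then obtain a where c_power: "a \<le> Suc k" "c = q ^ a"
      using divides_primepow_nat[OF assms] by blast
    show "d \<in> ?R"
    proof (cases "a = Suc k")
      case True
      then show ?thesis using factors c_power by auto
    next
      case False
      then have "c dvd q ^ k" using c_power by (simp add: le_imp_power_dvd)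
      then show ?thesis using factors by (simp add: mult_dvd_mono)
    qed
  qed
qed

lemma distinct_totient_sums_mult_prime_power:
  fixes m q k :: nat
  assumes distinct: "distinct_subset_sums totient {d. d dvd m}" and "m > 0"
    and q: "prime q" "m + 1 < q"
  shows "distinct_subset_sums totient {d. d dvd m * q ^ k}"
proof (induction k)
  case 0
  then show ?case using distinct by simp
next
  case (Suc k)
  let ?Q = "q ^ Suc k" and ?layer = "(\<lambda>d. d * q ^ Suc k) ` {d. d dvd m}"
  have "?Q \<noteq> 0" "totient ?Q \<noteq> 0" using q prime_gt_0_nat by simp_all
  have totient_layer: "totient (d * ?Q) = totient ?Q * totient d" if "d dvd m" for d
  proof -
    have "\<not> q dvd m" using \<open>m > 0\<close> q(2) by (auto dest: dvd_imp_le)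
    then have "\<not> q dvd d" using that dvd_trans by blast
    then have "coprime d ?Q"
      using q(1) by (metis coprime_commute coprime_power_right_iff prime_imp_coprime)
    then show ?thesis by (simp add: totient_mult_coprime)
  qed
  show ?case
    unfolding divisors_mult_prime_power_Suc[OF q(1)]
  proof (rule distinct_subset_sums_Un)
    show "distinct_subset_sums totient ?layer"
      by (rule distinct_subset_sums_pullback[OF distinct, where h = "\<lambda>d. d div ?Q"
            and c = "totient ?Q"])
        (use \<open>?Q \<noteq> 0\<close> \<open>totient ?Q \<noteq> 0\<close> totient_layer in \<open>auto simp: inj_on_def\<close>)
    have "m < q - 1" using q(2) by linarith
    then have "m * q ^ k < (q - 1) * q ^ k" using q prime_gt_0_nat by simp
    then show "(\<Sum>d | d dvd m * q ^ k. totient d) < totient ?Q"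
      using q(1)
      by (simp add: totient_divisor_sum totient_prime_power_Suc mult.commute del: power_Suc)
  qed (use Suc.IH \<open>m > 0\<close> q totient_layer prime_gt_0_nat in auto)
qed

lemma distinct_totient_sums_prod_prime_powers:
  fixes p J :: "nat \<Rightarrow> nat"
  assumes "\<And>i. i \<in> {1..r} \<Longrightarrow> prime (p i) \<and> odd (p i)"
    and "\<And>k. k \<in> {1..<r} \<Longrightarrow> (\<Prod>i=1..k. p i ^ J i) < p (k + 1)"
  shows "distinct_subset_sums totient {d. d dvd (\<Prod>i=1..r. p i ^ J i)}"
  using assms
proof (induction r)
  case 0
  have "Pow {d::nat. d dvd 1} = {{}, {1}}" by auto
  then show ?case by (simp add: distinct_subset_sums_def inj_on_def)
next
  case (Suc r)
  let ?m = "\<Prod>i=1..r. p i ^ J i"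
  have q: "prime (p (Suc r))" "odd (p (Suc r))" using Suc.prems(1)[of "Suc r"] by auto
  have "odd ?m" using Suc.prems(1) by (simp add: even_prod_iff)
  have "?m < p (Suc r)"
    using Suc.prems(2)[of r] prime_gt_1_nat[OF q(1)] by (cases "r = 0") auto
  moreover have "?m + 1 \<noteq> p (Suc r)" using \<open>odd ?m\<close> q(2) by (metis even_plus_one_iff)
  ultimately have "?m + 1 < p (Suc r)" by linarith
  then have "distinct_subset_sums totient {d. d dvd ?m * p (Suc r) ^ J (Suc r)}"
    using Suc.IH Suc.prems q(1) odd_pos[OF \<open>odd ?m\<close>]
    by (intro distinct_totient_sums_mult_prime_power) auto
  then show ?case by simp
qed

section \<open>Roots of unity\<close>

definition unity_root :: "nat \<Rightarrow> int \<Rightarrow> complex" where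
  "unity_root n a = cis (2 * pi * of_int a / of_nat n)"

lemma norm_unity_root [simp]: "norm (unity_root n a) = 1"
  by (simp add: unity_root_def)

lemma unity_root_0 [simp]: "unity_root n 0 = 1"
  by (simp add: unity_root_def)

lemma unity_root_add: "unity_root n (a + b) = unity_root n a * unity_root n b"
  by (simp add: unity_root_def cis_mult add_divide_distrib ring_distribs)

lemma unity_root_power: "unity_root n (a * int k) = unity_root n a ^ k"
  by (simp add: unity_root_def DeMoivre mult_ac)

lemma unity_root_eq_1_iff:
  assumes "n > 0"
  shows "unity_root n a = 1 \<longleftrightarrow> int n dvd a"
proof -
  have "2 * pi * of_int a / of_nat n = of_int k * (2 * pi) \<longleftrightarrow> a = int n * k" for k
  proof -
    have "2 * pi * of_int a / of_nat n = of_int k * (2 * pi) \<longleftrightarrow>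
        real_of_int a = real_of_int (int n * k)"
      using assms by (simp add: field_simps)
    then show ?thesis by (simp only: of_int_eq_iff)
  qed
  then show ?thesis by (simp add: unity_root_def cis_eq_1_iff dvd_def)
qed

lemma unity_root_cong:
  assumes "n > 0" and "[a = b] (mod int n)"
  shows "unity_root n a = unity_root n b"
proof -
  have "unity_root n (a - b) = 1"
    using assms by (simp add: unity_root_eq_1_iff cong_iff_dvd_diff)
  then show ?thesis using unity_root_add[of n "a - b" b] by simp
qed

lemma sum_unity_root:
  assumes "n > 0"
  shows "(\<Sum>k<n. unity_root n (a * int k)) = (if int n dvd a then of_nat n else 0)"
proof (cases "int n dvd a")
  case True
  then show ?thesis using assms by (simp add: unity_root_power iffD2[OF unity_root_eq_1_iff])
next
  case False
  have "unity_root n a ^ n = 1"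
    using assms by (simp add: unity_root_eq_1_iff flip: unity_root_power)
  moreover have "unity_root n a \<noteq> 1" using False assms by (simp add: unity_root_eq_1_iff)
  ultimately show ?thesis using False by (simp add: unity_root_power geometric_sum)
qed

section \<open>The spectrum of a circulant graph\<close>

definition circulant_eigenvalue :: "nat \<Rightarrow> nat set \<Rightarrow> nat \<Rightarrow> complex" where
  "circulant_eigenvalue n S k = (\<Sum>l\<in>S. unity_root n (int l * int k))"

lemma circulant_eigenvalue_0 [simp]: "circulant_eigenvalue n S 0 = of_nat (card S)"
  by (simp add: circulant_eigenvalue_def)

lemma norm_circulant_eigenvalue_le: "norm (circulant_eigenvalue n S k) \<le> real (card S)"
  unfolding circulant_eigenvalue_def by (rule order_trans[OF norm_sum]) simp

lemma zn_rep_in_range: "n > 0 \<Longrightarrow> zn_rep n a \<in> {1..n}"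
  using pos_mod_bound[of "int n" a] pos_mod_sign[of "int n" a]
  by (auto simp: zn_rep_def nat_le_iff simp del: pos_mod_bound pos_mod_sign)

lemma cong_zn_rep: "n > 0 \<Longrightarrow> [int (zn_rep n a) = a] (mod int n)"
  by (auto simp: zn_rep_def cong_def)

lemma bij_betw_zn_rep_diff:
  assumes "n > 0"
  shows "bij_betw (\<lambda>j. zn_rep n (int j - a)) {..<n} {1..n}"
proof -
  let ?f = "\<lambda>j. zn_rep n (int j - a)"
  have "inj_on ?f {..<n}"
  proof (rule inj_onI)
    fix i j assume ij: "i \<in> {..<n}" "j \<in> {..<n}" and "?f i = ?f j"
    then have "[int i - a = int j - a] (mod int n)"
      using cong_zn_rep[OF assms] by (metis cong_trans cong_sym)
    then have "[i = j] (mod n)"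
      using cong_add_rcancel[of "int i" "- a" "int j" "int n"] by (simp add: cong_int_iff)
    then show "i = j" using ij by (auto simp: cong_def)
  qed
  moreover have "?f ` {..<n} = {1..n}"
    by (rule card_subset_eq) (use zn_rep_in_range[OF assms] card_image[OF calculation] in auto)
  ultimately show ?thesis by (rule bij_betw_imageI)
qed

definition fourier_mat :: "nat \<Rightarrow> complex mat" where
  "fourier_mat n = mat n n (\<lambda>(i, k). unity_root n (int i * int k))"

definition inverse_fourier_mat :: "nat \<Rightarrow> complex mat" where
  "inverse_fourier_mat n = mat n n (\<lambda>(k, j). unity_root n (- (int k * int j)) / of_nat n)"

lemma fourier_mat_carrier [simp]:
  "fourier_mat n \<in> carrier_mat n n" "inverse_fourier_mat n \<in> carrier_mat n n"
  by (simp_all add: fourier_mat_def inverse_fourier_mat_def)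

lemma fourier_mat_mult_inverse:
  assumes "n > 0"
  shows "fourier_mat n * inverse_fourier_mat n = 1\<^sub>m n"
proof (rule eq_matI)
  fix i j assume "i < dim_row (1\<^sub>m n :: complex mat)" "j < dim_col (1\<^sub>m n :: complex mat)"
  then have ij: "i < n" "j < n" by auto
  have "unity_root n (int i * int k) * unity_root n (- (int k * int j)) =
      unity_root n ((int i - int j) * int k)" for k
    by (simp add: algebra_simps flip: unity_root_add)
  then have "(fourier_mat n * inverse_fourier_mat n) $$ (i, j) =
      (\<Sum>k<n. unity_root n ((int i - int j) * int k)) / of_nat n"
    using ij by (simp add: fourier_mat_def inverse_fourier_mat_def scalar_prod_def
      lessThan_atLeast0 sum_divide_distrib)
  also have "\<dots> = (if int n dvd int i - int j then 1 else 0)"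
    using assms by (simp add: sum_unity_root)
  also have "int n dvd int i - int j \<longleftrightarrow> i = j"
    using ij by (simp add: cong_int_iff cong_def flip: cong_iff_dvd_diff)
  finally show "(fourier_mat n * inverse_fourier_mat n) $$ (i, j) = 1\<^sub>m n $$ (i, j)"
    using ij by simp
qed (simp_all add: fourier_mat_def inverse_fourier_mat_def)

lemma sum_circulant_row_unity_root:
  assumes "n > 0" and "S \<subseteq> {1..n}"
  shows "(\<Sum>j<n. (if zn_rep n (int j - int i) \<in> S then 1 else 0) * unity_root n (int j * int k)) =
    unity_root n (int i * int k) * circulant_eigenvalue n S k"
proof -
  let ?f = "\<lambda>j. zn_rep n (int j - int i)"
  define h where "h l = (if l \<in> S then unity_root n ((int i + int l) * int k) else 0)" for l
  have "(if ?f j \<in> S then 1 else 0) * unity_root n (int j * int k) = h (?f j)" for j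
  proof -
    have "[int i + (int j - int i) = int i + int (?f j)] (mod int n)"
      using cong_zn_rep[OF assms(1)] by (intro cong_add cong_refl) (rule cong_sym)
    then have "[int j * int k = (int i + int (?f j)) * int k] (mod int n)"
      by (intro cong_mult) auto
    then show ?thesis by (simp add: h_def unity_root_cong[OF assms(1)])
  qed
  then have "(\<Sum>j<n. (if ?f j \<in> S then 1 else 0) * unity_root n (int j * int k)) =
      (\<Sum>j<n. h (?f j))"
    by simp
  also have "\<dots> = (\<Sum>l\<in>{1..n}. h l)"
    by (rule sum.reindex_bij_betw[OF bij_betw_zn_rep_diff[OF assms(1)]])
  also have "\<dots> = (\<Sum>l\<in>S. unity_root n ((int i + int l) * int k))"
    by (rule sum.mono_neutral_cong_right) (use assms(2) in \<open>auto simp: h_def\<close>)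
  also have "\<dots> = unity_root n (int i * int k) * circulant_eigenvalue n S k"
    by (simp add: circulant_eigenvalue_def sum_distrib_left distrib_right unity_root_add)
  finally show ?thesis .
qed

lemma circulant_adj_mult_fourier_mat:
  assumes "n > 0" and "S \<subseteq> {1..n}"
  shows "circulant_adj n S * fourier_mat n =
    fourier_mat n * mat_diag n (circulant_eigenvalue n S)"
    (is "?L = ?R")
proof (rule eq_matI)
  fix i k assume "i < dim_row ?R" "k < dim_col ?R"
  then have ik: "i < n" "k < n" by (auto simp: fourier_mat_def mat_diag_def)
  then have "?L $$ (i, k) =
      (\<Sum>j<n. (if zn_rep n (int j - int i) \<in> S then 1 else 0) * unity_root n (int j * int k))"
    by (simp add: circulant_adj_def fourier_mat_def scalar_prod_def lessThan_atLeast0)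
  also have "\<dots> = unity_root n (int i * int k) * circulant_eigenvalue n S k"
    by (rule sum_circulant_row_unity_root[OF assms])
  also have "\<dots> = ?R $$ (i, k)"
    using ik
    by (simp add: mat_diag_mult_right[OF fourier_mat_carrier(1)]) (simp add: fourier_mat_def)
  finally show "?L $$ (i, k) = ?R $$ (i, k)" .
qed (simp_all add: circulant_adj_def fourier_mat_def mat_diag_def)

lemma similar_mat_circulant_adj_diag:
  assumes "n > 0" and "S \<subseteq> {1..n}"
  shows "similar_mat (circulant_adj n S) (mat_diag n (circulant_eigenvalue n S))"
proof (rule similar_matI)
  let ?A = "circulant_adj n S" and ?P = "fourier_mat n" and ?Q = "inverse_fourier_mat n"
  let ?D = "mat_diag n (circulant_eigenvalue n S)"
  have A: "?A \<in> carrier_mat n n" by (simp add: circulant_adj_def)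
  then show "{?A, ?D, ?P, ?Q} \<subseteq> carrier_mat n n" by simp
  show PQ: "?P * ?Q = 1\<^sub>m n" by (rule fourier_mat_mult_inverse[OF assms(1)])
  then show "?Q * ?P = 1\<^sub>m n" by (rule mat_mult_left_right_inverse[rotated 2]) simp_all
  have "?P * ?D * ?Q = ?A * ?P * ?Q" by (simp only: circulant_adj_mult_fourier_mat[OF assms])
  also have "\<dots> = ?A * (?P * ?Q)" by (rule assoc_mult_mat[OF A fourier_mat_carrier])
  also have "\<dots> = ?A" using A by (simp add: PQ)
  finally show "?A = ?P * ?D * ?Q" ..
qed

lemma Spec_similar_mat_diag:
  assumes "similar_mat A (mat_diag n e)"
  shows "Spec A = image_mset e (mset_set {..<n})"
proof -
  have "char_poly A = (\<Prod>a\<leftarrow>diag_mat (mat_diag n e). [:- a, 1:])"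
    unfolding char_poly_similar[OF assms]
    by (rule char_poly_upper_triangular[of _ n]) (auto simp: mat_diag_def)
  also have "diag_mat (mat_diag n e) = map e [0..<n]"
    by (auto simp: diag_mat_def mat_diag_def)
  finally have "char_poly A = (\<Prod>k<n. [:- e k, 1:])"
    by (simp add: prod.list_conv_set_nth lessThan_atLeast0)
  then have "Spec A = (\<Sum>k<n. {#e k#})"
    by (simp add: Spec_def proots_prod)
  then show ?thesis by (simp add: sum_unfold_sum_mset)
qed

lemma Spec_circulant_adj:
  assumes "n > 0" and "S \<subseteq> {1..n}"
  shows "Spec (circulant_adj n S) = image_mset (circulant_eigenvalue n S) (mset_set {..<n})"
  by (rule Spec_similar_mat_diag[OF similar_mat_circulant_adj_diag[OF assms]])

lemma Max_norm_Spec_circulant_adj: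
  assumes "n > 0" and "S \<subseteq> {1..n}"
  shows "Max (norm ` set_mset (Spec (circulant_adj n S))) = card S"
proof (rule Max_eqI)
  show "real (card S) \<in> norm ` set_mset (Spec (circulant_adj n S))"
    using assms(1) circulant_eigenvalue_0[of n S] by (force simp: Spec_circulant_adj[OF assms])
qed (auto simp: Spec_circulant_adj[OF assms] norm_circulant_eigenvalue_le)

definition symmetric_conn_set :: "nat \<Rightarrow> nat set \<Rightarrow> bool" where
  "symmetric_conn_set n S \<longleftrightarrow> S \<subseteq> {0<..<n} \<and> (\<forall>l\<in>S. n - l \<in> S)"

lemma symmetric_conn_set_imp_subset: "symmetric_conn_set n S \<Longrightarrow> S \<subseteq> {1..n}"
  by (force simp: symmetric_conn_set_def)

lemma circulant_eigenvalue_reflect: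
  assumes sym: "symmetric_conn_set n S" and "n > 0" "k \<le> n"
  shows "circulant_eigenvalue n S (n - k) = circulant_eigenvalue n S k"
proof -
  have "bij_betw (\<lambda>l. n - l) S S"
    by (rule bij_betw_byWitness[of _ "\<lambda>l. n - l"])
      (use sym in \<open>force simp: symmetric_conn_set_def\<close>)+
  then have "circulant_eigenvalue n S k = (\<Sum>l\<in>S. unity_root n (int (n - l) * int k))"
    unfolding circulant_eigenvalue_def by (rule sum.reindex_bij_betw[symmetric])
  also have "\<dots> = (\<Sum>l\<in>S. unity_root n (int l * int (n - k)))"
  proof (intro sum.cong refl unity_root_cong)
    fix l assume "l \<in> S"
    then have "l \<le> n" using symmetric_conn_set_imp_subset[OF sym] by auto
    then have "int (n - l) * int k - int l * int (n - k) = int n * (int k - int l)"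
      using \<open>k \<le> n\<close> by (simp add: algebra_simps)
    then show "[int (n - l) * int k = int l * int (n - k)] (mod int n)"
      by (simp add: cong_iff_dvd_diff)
  qed (rule \<open>n > 0\<close>)
  finally show ?thesis by (simp add: circulant_eigenvalue_def)
qed

lemma image_mset_lessThan_double_reflect:
  fixes m :: nat
  assumes "m > 0" and reflect: "\<And>k. k \<le> 2 * m \<Longrightarrow> f (2 * m - k) = f k"
  shows "image_mset f (mset_set {..<2 * m}) =
    add_mset (f 0) (add_mset (f m) (repeat_mset 2 (image_mset f (mset_set {0<..<m}))))"
proof -
  have "bij_betw (\<lambda>k. 2 * m - k) {0<..<m} {m<..<2 * m}"
    by (rule bij_betw_byWitness[of _ "\<lambda>k. 2 * m - k"]) auto
  then have "mset_set {m<..<2 * m} = image_mset (\<lambda>k. 2 * m - k) (mset_set {0<..<m})"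
    by (simp add: image_mset_mset_set bij_betw_def)
  then have "image_mset f (mset_set {m<..<2 * m}) = image_mset f (mset_set {0<..<m})"
    by (auto simp: multiset.map_comp reflect intro!: image_mset_cong)
  moreover have "{..<2 * m} = insert 0 (insert m ({0<..<m} \<union> {m<..<2 * m}))"
    using \<open>m > 0\<close> by auto
  ultimately show ?thesis using \<open>m > 0\<close> by (simp add: mset_set_Union numeral_2_eq_2)
qed

lemma Spec_circulant_adj_symmetric:
  assumes "m > 0" and sym: "symmetric_conn_set (2 * m) S"
  defines "e \<equiv> circulant_eigenvalue (2 * m) S"
  shows "Spec (circulant_adj (2 * m) S) =
    add_mset (e 0) (add_mset (e m) (repeat_mset 2 (image_mset e (mset_set {0<..<m}))))"
proof -
  have "2 * m > 0" using \<open>m > 0\<close> by simp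
  then have "Spec (circulant_adj (2 * m) S) = image_mset e (mset_set {..<2 * m})"
    unfolding e_def by (intro Spec_circulant_adj symmetric_conn_set_imp_subset sym)
  then show ?thesis
    using image_mset_lessThan_double_reflect[OF \<open>m > 0\<close>, of e]
      circulant_eigenvalue_reflect[OF sym \<open>2 * m > 0\<close>] by (simp add: e_def)
qed

lemma add_mset_repeat_2_eq_imp_eq:
  assumes "add_mset a (repeat_mset 2 M) = add_mset b (repeat_mset 2 N)"
  shows "a = b"
proof -
  have "odd (count (add_mset c (repeat_mset 2 K)) x) \<longleftrightarrow> x = c" for c x :: 'a and K
    by simp
  then show ?thesis using assms by metis
qed

lemma circulant_eigenvalue_half:
  assumes "m > 0" "finite S"
  shows "circulant_eigenvalue (2 * m) S m =
    of_int (int (card (S \<inter> Collect even)) - int (card (S - Collect even)))"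
proof -
  have "unity_root (2 * m) (int m) = - 1"
    using assms(1) by (simp add: unity_root_def)
  then have "unity_root (2 * m) (int l * int m) = (if even l then 1 else - 1)" for l
    by (simp add: mult.commute[of "int l"] unity_root_power minus_one_power_iff)
  then show ?thesis
    using assms(2) by (simp add: circulant_eigenvalue_def sum.If_cases Diff_eq)
qed

lemma Spec_circulant_adj_eq_imp_parity_counts_eq:
  assumes "m > 0" and sym: "symmetric_conn_set (2 * m) S" "symmetric_conn_set (2 * m) T"
    and eq: "Spec (circulant_adj (2 * m) S) = Spec (circulant_adj (2 * m) T)"
  shows "card (S \<inter> Collect even) = card (T \<inter> Collect even)"
    and "card (S - Collect even) = card (T - Collect even)"
proof -
  note range = symmetric_conn_set_imp_subset[OF sym(1)] symmetric_conn_set_imp_subset[OF sym(2)]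
  have fin: "finite S" "finite T" using range by (blast intro: finite_subset)+
  have "2 * m > 0" using \<open>m > 0\<close> by simp
  have card_eq: "card S = card T"
    using Max_norm_Spec_circulant_adj[OF \<open>2 * m > 0\<close>] range eq by (metis of_nat_eq_iff)
  have "circulant_eigenvalue (2 * m) S m = circulant_eigenvalue (2 * m) T m"
    using eq card_eq unfolding Spec_circulant_adj_symmetric[OF \<open>m > 0\<close> sym(1)]
      Spec_circulant_adj_symmetric[OF \<open>m > 0\<close> sym(2)]
    by (auto intro: add_mset_repeat_2_eq_imp_eq)
  then have "int (card (S \<inter> Collect even)) - int (card (S - Collect even)) =
      int (card (T \<inter> Collect even)) - int (card (T - Collect even))"
    unfolding circulant_eigenvalue_half[OF \<open>m > 0\<close> fin(1)]
      circulant_eigenvalue_half[OF \<open>m > 0\<close> fin(2)]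
    by (simp only: of_int_eq_iff)
  moreover have "card (S \<inter> Collect even) + card (S - Collect even) =
      card (T \<inter> Collect even) + card (T - Collect even)"
    using card_eq card_Int_Diff fin by metis
  ultimately show "card (S \<inter> Collect even) = card (T \<inter> Collect even)"
    and "card (S - Collect even) = card (T - Collect even)"
    by linarith+
qed

section \<open>Integral circulant graphs\<close>

lemma symmetric_conn_set_conn_set:
  assumes "D \<subseteq> divisors_n n - {n}"
  shows "symmetric_conn_set n (conn_set n D)"
  unfolding symmetric_conn_set_def
proof (intro conjI ballI)
  show range: "conn_set n D \<subseteq> {0<..<n}"
  proof
    fix l assume "l \<in> conn_set n D"
    then have "1 \<le> l" "l \<le> n" "gcd l n \<noteq> n" using assms by (auto simp: conn_set_def G_n_def)
    then show "l \<in> {0<..<n}" by (cases "l = n") auto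
  qed
  fix l assume l: "l \<in> conn_set n D"
  then have "0 < l" "l < n" using range by auto
  moreover have "gcd (n - l) n = gcd l n" using \<open>l < n\<close> by (metis gcd_diff2_nat less_imp_le_nat)
  ultimately show "n - l \<in> conn_set n D" using l by (auto simp: conn_set_def G_n_def)
qed

lemma conn_set_Int_even:
  assumes "even n"
  shows "conn_set n D \<inter> Collect even = conn_set n (D \<inter> Collect even)"
  using assms by (auto simp: conn_set_def G_n_def)

lemma conn_set_Diff_even:
  assumes "even n"
  shows "conn_set n D - Collect even = conn_set n (D - Collect even)"
  using assms by (auto simp: conn_set_def G_n_def)

lemma card_conn_set:
  assumes "n > 0" and "D \<subseteq> divisors_n n"
  shows "card (conn_set n D) = (\<Sum>d\<in>D. totient (n div d))"
proof -
  have "finite D"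
    by (rule finite_subset[OF assms(2)]) (use \<open>n > 0\<close> in \<open>simp add: divisors_n_def\<close>)
  then have "card (conn_set n D) = (\<Sum>d\<in>D. card (G_n n d))"
    unfolding conn_set_def by (intro card_UN_disjoint) (auto simp: G_n_def)
  also have "\<dots> = (\<Sum>d\<in>D. totient (n div d))"
  proof (rule sum.cong)
    fix d assume "d \<in> D"
    then have "d dvd n" using assms(2) by (auto simp: divisors_n_def)
    moreover have "G_n n d = {k\<in>{0<..n}. gcd k n = d}" by (auto simp: G_n_def)
    ultimately show "card (G_n n d) = totient (n div d)"
      using card_gcd_eq_totient[OF \<open>n > 0\<close>] by simp
  qed simp
  finally show ?thesis .
qed

lemma inj_on_div_divisors:
  fixes n :: nat
  assumes "n > 0"
  shows "inj_on (\<lambda>d. n div d) {d. d dvd n}"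
  using assms by (auto intro!: inj_on_inverseI[where g = "\<lambda>d. n div d"] simp: div_div_eq_right)

lemma distinct_codivisor_totient_sums_even:
  assumes "distinct_subset_sums totient {d. d dvd m}" and "m > 0"
  shows "distinct_subset_sums (\<lambda>d. totient (2 * m div d)) (divisors_n (2 * m) \<inter> Collect even)"
proof (rule distinct_subset_sums_pullback[OF assms(1), where h = "\<lambda>d. 2 * m div d" and c = 1])
  show "inj_on (\<lambda>d. 2 * m div d) (divisors_n (2 * m) \<inter> Collect even)"
    by (rule inj_on_subset[OF inj_on_div_divisors]) (use assms(2) in \<open>auto simp: divisors_n_def\<close>)
  show "(\<lambda>d. 2 * m div d) ` (divisors_n (2 * m) \<inter> Collect even) \<subseteq> {d. d dvd m}"
    by (auto simp: divisors_n_def elim!: evenE)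
qed simp_all

lemma distinct_codivisor_totient_sums_odd:
  assumes "distinct_subset_sums totient {d. d dvd m}" and "odd m"
  shows "distinct_subset_sums (\<lambda>d. totient (2 * m div d)) (divisors_n (2 * m) - Collect even)"
proof (rule distinct_subset_sums_pullback[OF assms(1), where h = "\<lambda>d. m div d" and c = 1])
  have dvd: "d dvd m" if "d \<in> divisors_n (2 * m) - Collect even" for d
    using that by (auto simp: divisors_n_def coprime_dvd_mult_right_iff)
  show "inj_on (\<lambda>d. m div d) (divisors_n (2 * m) - Collect even)"
    by (rule inj_on_subset[OF inj_on_div_divisors[OF odd_pos[OF assms(2)]]]) (use dvd in blast)
  show "(\<lambda>d. m div d) ` (divisors_n (2 * m) - Collect even) \<subseteq> {d. d dvd m}"
    by (rule image_subsetI) (metis dvd dvd_mult_div_cancel dvd_triv_right mem_Collect_eq)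
  show "totient (2 * m div d) = 1 * totient (m div d)"
    if "d \<in> divisors_n (2 * m) - Collect even" for d
  proof -
    have "odd (m div d)" using dvd[OF that] assms(2) by (metis dvd_mult_div_cancel even_mult_iff)
    then show ?thesis by (simp add: totient_double flip: div_mult_swap[OF dvd[OF that]])
  qed
qed simp

lemma ICG_Spec_inject:
  assumes "odd m" and distinct: "distinct_subset_sums totient {d. d dvd m}"
    and D: "D1 \<subseteq> divisors_n (2 * m) - {2 * m}" "D2 \<subseteq> divisors_n (2 * m) - {2 * m}"
    and eq: "Spec (ICG_adj (2 * m) D1) = Spec (ICG_adj (2 * m) D2)"
  shows "D1 = D2"
proof -
  have "m > 0" using \<open>odd m\<close> by (rule odd_pos)
  have sub: "D1 \<subseteq> divisors_n (2 * m)" "D2 \<subseteq> divisors_n (2 * m)" using D by auto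
  let ?f = "\<lambda>d. totient (2 * m div d)"
  note counts_eq = Spec_circulant_adj_eq_imp_parity_counts_eq[OF \<open>m > 0\<close>
      symmetric_conn_set_conn_set[OF D(1)] symmetric_conn_set_conn_set[OF D(2)]
      eq[unfolded ICG_adj_def]]
  have card_eq_sum: "card (conn_set (2 * m) D) = sum ?f D" if "D \<subseteq> divisors_n (2 * m)" for D
    using card_conn_set[OF _ that] \<open>m > 0\<close> by simp
  have "sum ?f (D1 \<inter> Collect even) = sum ?f (D2 \<inter> Collect even)"
    using counts_eq(1) sub by (simp add: conn_set_Int_even card_eq_sum le_infI1)
  then have "D1 \<inter> Collect even = D2 \<inter> Collect even"
    using sub distinct_codivisor_totient_sums_even[OF distinct \<open>m > 0\<close>]
    by (intro distinct_subset_sumsD) auto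
  moreover have "sum ?f (D1 - Collect even) = sum ?f (D2 - Collect even)"
    using counts_eq(2) sub
    by (simp add: conn_set_Diff_even card_eq_sum subset_trans[OF Diff_subset])
  then have "D1 - Collect even = D2 - Collect even"
    using sub distinct_codivisor_totient_sums_odd[OF distinct \<open>odd m\<close>]
    by (intro distinct_subset_sumsD) auto
  ultimately show "D1 = D2" by blast
qed

theorem theorem1p4:
  fixes n s :: nat and p J :: "nat \<Rightarrow> nat" and D1 D2 :: "nat set"
  assumes "s \<ge> 2"
    and "\<And>i. i \<in> {1..s} \<Longrightarrow> prime (p i) \<and> odd (p i) \<and> J i \<ge> 1"
    and "inj_on p {1..s}"
    and "\<And>r. r \<in> {1..s-1} \<Longrightarrow> (\<Prod>i=1..r. p i ^ J i) < p (r + 1)"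
    and "n = 2 * (\<Prod>i=1..s. p i ^ J i)"
    and "D1 \<subseteq> divisors_n n - {n}"
    and "D2 \<subseteq> divisors_n n - {n}"
    and "Spec (ICG_adj n D1) = Spec (ICG_adj n D2)"
  shows "D1 = D2"
proof -
  define m where "m = (\<Prod>i=1..s. p i ^ J i)"
  have n: "n = 2 * m" using assms(5) by (simp add: m_def)
  have "odd m" using assms(2) by (simp add: m_def even_prod_iff)
  moreover have "distinct_subset_sums totient {d. d dvd m}"
    unfolding m_def by (rule distinct_totient_sums_prod_prime_powers) (use assms(2,4) in auto)
  ultimately show ?thesis using assms(6-8) unfolding n by (rule ICG_Spec_inject)
qed

end
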